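(* Let $u,v\in\ell^+$. The inequality \[ \sup_{n\ge1}\Big|\sum_{k=n}^\infty\frac{x_k}k\Big|v_n\le A\sup_{k\ge1}\frac{|x_k|}{u_k} \] holds for all real sequences $x\in\mathcal D(C^* )$ with $A=A(C^* )$; for all nonnegative sequences $x\in\mathcal D(C^* )$ with $A=A^+(C^* )$; for all nonnegative, nonincreasing sequences $x\in\mathcal D(C^* )$ with $A=A^\downarrow(C^* )$; and for all nonnegative, nondecreasing sequences $x\in\mathcal D(C^* )$ with $A=A^\uparrow(C^* )$. In each case the constant $A$ is best possible (the least in $[0,\infty]$). Here \begin{align*} A(C^* )=A^+(C^* )&=\|C^*u\|_{\ell^\infty(v)}=\sup_{n\ge1}v_n\sum_{k=n}^\infty\frac{u_k}k;\\ A^\downarrow(C^* )&=\|C^*(u^\downarrow)\|_{\ell^\infty(v)}=\sup_{n\ge1}v_n\sum_{k=n}^\infty\frac1k\min_{1\le j\le k}u_j;\\ A^\uparrow(C^* )&=0, \end{align*} where in the last case $\ell^\uparrow\cap\mathcal D(C^* )=\{0\}$.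
   Context: $\ell^+$ is the set of nonnegative real sequences indexed by the positive integers, and $\ell^\uparrow$ the set of nondecreasing sequences of nonnegative reals. $(C^*x)_n=\sum_{k=n}^\infty\frac{x_k}k$; $\mathcal D(C^* )$ is the set of all real sequences $x$ for which $\sum_{k=1}^\infty\frac{x_k}k$ converges (possibly conditionally) in $\mathbb R$; for nonnegative sequences outside $\mathcal D(C^* )$ the value $\infty$ is allowed for $(C^*x)_n$. $\|y\|_{\ell^\infty(v)}=\sup_n|y_n|v_n$; $u^\downarrow_k=\min_{j\le k}u_j$. If $u_k=0$, then $|x_k|/u_k$ is $0$ when $x_k=0$ and $\infty$ when $x_k\ne0$. Suprema take values in $[0,\infty]$. Conventions: $\infty\cdot0=0$ in products with $v_n$ and when $A=\infty$ and the supremum on the right is $0$; the inequality is regarded as holding whenever the supremum on the right-hand side is $\infty$ (even if $A=0$). *)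

theory Defs
  imports Complex_Main "HOL-Library.Extended_Nonnegative_Real"
begin

text \<open>
  A sequence indexed by the positive integers is a function on \<open>nat\<close> of which only the values at
  arguments \<open>n \<ge> 1\<close> matter; nothing below depends on \<open>x 0\<close>. Suprema and constants live in
  \<open>[0, \<infinity>] = ennreal\<close>, where \<open>\<infinity> * 0 = 0\<close>, \<open>0 / 0 = 0\<close> and \<open>a / 0 = \<infinity>\<close> for \<open>a \<noteq> 0\<close>.
\<close>

definition nonneg_seqs :: "(nat \<Rightarrow> real) set" where
  "nonneg_seqs = {x. \<forall>n\<ge>1. 0 \<le> x n}"

definition noninc_seqs :: "(nat \<Rightarrow> real) set" where
  "noninc_seqs = {x \<in> nonneg_seqs. antimono_on {1..} x}"

definition nondec_seqs :: "(nat \<Rightarrow> real) set" where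
  "nondec_seqs = {x \<in> nonneg_seqs. mono_on {1..} x}"

definition dom_Cstar :: "(nat \<Rightarrow> real) set" where
  "dom_Cstar = {x. summable (\<lambda>k. x (Suc k) / real (Suc k))}"

text \<open>
  The sum over \<open>k \<ge> n\<close> of \<open>x k / k\<close>, for \<open>n \<ge> 1\<close>. The value \<open>\<infinity>\<close> outside the domain is the intended
  one for nonnegative \<open>x\<close>; for other \<open>x\<close> outside the domain it is a dummy value that is never used.
\<close>

definition Cstar :: "(nat \<Rightarrow> real) \<Rightarrow> nat \<Rightarrow> ereal" where
  "Cstar x n = (if x \<in> dom_Cstar then ereal (\<Sum>k. x (n + k) / real (n + k)) else \<infinity>)"

definition linf_norm :: "(nat \<Rightarrow> real) \<Rightarrow> (nat \<Rightarrow> ereal) \<Rightarrow> ennreal" where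
  "linf_norm v y = (SUP n\<in>{1..}. e2ennreal \<bar>y n\<bar> * ennreal (v n))"

definition ratio_sup :: "(nat \<Rightarrow> real) \<Rightarrow> (nat \<Rightarrow> real) \<Rightarrow> ennreal" where
  "ratio_sup u x = (SUP k\<in>{1..}. ennreal \<bar>x k\<bar> / ennreal (u k))"

definition down_seq :: "(nat \<Rightarrow> real) \<Rightarrow> nat \<Rightarrow> real" where
  "down_seq u k = Min (u ` {1..k})"

text \<open>
  The first disjunct is needed because \<open>0 * \<infinity> = 0\<close> in \<open>ennreal\<close>, whereas the inequality is regarded
  as true, also for \<open>A = 0\<close>, when the supremum on the right is infinite.
\<close>

definition Cstar_ineq :: "(nat \<Rightarrow> real) \<Rightarrow> (nat \<Rightarrow> real) \<Rightarrow> ennreal \<Rightarrow> (nat \<Rightarrow> real) \<Rightarrow> bool" where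
  "Cstar_ineq u v A x \<longleftrightarrow>
     ratio_sup u x = \<infinity> \<or> linf_norm v (Cstar x) \<le> A * ratio_sup u x"

definition best_constant ::
    "(nat \<Rightarrow> real) \<Rightarrow> (nat \<Rightarrow> real) \<Rightarrow> (nat \<Rightarrow> real) set \<Rightarrow> ennreal \<Rightarrow> bool" where
  "best_constant u v X A \<longleftrightarrow>
     (\<forall>x\<in>X. Cstar_ineq u v A x) \<and> (\<forall>B. (\<forall>x\<in>X. Cstar_ineq u v B x) \<longrightarrow> A \<le> B)"

end

theory Submission
  imports Defs "HOL-Analysis.Summation_Tests"
begin

text \<open>
  Write \<open>R\<close> for the supremum of \<open>\<bar>x k\<bar> / u k\<close>. If \<open>R\<close> is finite, then \<open>\<bar>x k\<bar> \<le> R * u k\<close> for all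
  \<open>k\<close>, and summing this over \<open>k \<ge> n\<close> with weights \<open>1 / k\<close> gives the inequality with the constant
  \<open>\<parallel>C\<^sup>* u\<parallel>\<close>. If \<open>x\<close> is nonnegative and nonincreasing, then also \<open>x k \<le> x j \<le> R * u j\<close> for every
  \<open>j \<le> k\<close>, so \<open>u\<close> can be replaced by its running minimum \<open>w\<close>. Both cases are optimal for the same
  reason: the majorant (\<open>u\<close> or \<open>w\<close>) would be an extremal sequence with \<open>R \<le> 1\<close>. It may lie outside
  the domain of \<open>C\<^sup>*\<close>, but its truncations lie inside, are nonnegative, are nonincreasing in the
  case of \<open>w\<close>, and have norms that increase to that of the majorant. The lemma \<open>best_constant_of_majorant\<close> carries out
  this argument for a general majorant.

  A nondecreasing sequence that is positive somewhere is bounded below by a positive constant from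
  there on, so the divergence of the harmonic series keeps it out of the domain. Only sequences that
  vanish at all positive indices remain, and for them every constant, in particular \<open>0\<close>, is
  admissible.
\<close>

section \<open>Tail sums in the extended nonnegative reals\<close>

definition tail_sum :: "(nat \<Rightarrow> real) \<Rightarrow> nat \<Rightarrow> ennreal" where
  "tail_sum w n = (\<Sum>k. ennreal (w (n + k) / real (n + k)))"

definition truncate :: "nat \<Rightarrow> (nat \<Rightarrow> real) \<Rightarrow> nat \<Rightarrow> real" where
  "truncate N w k = (if k < N then w k else 0)"

lemma summable_tail_iff:
  assumes "n \<ge> 1"
  shows "summable (\<lambda>k. x (n + k) / real (n + k)) \<longleftrightarrow> x \<in> dom_Cstar"
proof -
  from assms obtain m where n: "n = Suc m" by (cases n) auto
  show ?thesis
    using summable_iff_shift[of "\<lambda>k. x (Suc k) / real (Suc k)" m]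
    by (simp add: n dom_Cstar_def add.commute)
qed

text \<open>
  For nonnegative sequences the value \<open>\<infinity>\<close> of \<open>Cstar\<close> outside its domain is the true sum of the
  divergent series.
\<close>

lemma Cstar_nonneg:
  assumes w: "w \<in> nonneg_seqs" and n: "n \<ge> 1"
  shows "e2ennreal \<bar>Cstar w n\<bar> = tail_sum w n"
proof -
  have nonneg: "0 \<le> w (n + k) / real (n + k)" for k
    using w n by (simp add: nonneg_seqs_def)
  show ?thesis
  proof (cases "w \<in> dom_Cstar")
    case True
    then have "summable (\<lambda>k. w (n + k) / real (n + k))"
      using summable_tail_iff[OF n] by blast
    moreover from this have "tail_sum w n = ennreal (\<Sum>k. w (n + k) / real (n + k))"
      unfolding tail_sum_def by (rule suminf_ennreal2[OF nonneg])
    moreover have "0 \<le> (\<Sum>k. w (n + k) / real (n + k))"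
      using calculation(1) nonneg by (rule suminf_nonneg)
    ultimately show ?thesis
      using True by (simp add: Cstar_def)
  next
    case False
    then have "\<not> summable (\<lambda>k. w (n + k) / real (n + k))"
      using summable_tail_iff[OF n] by blast
    then have "tail_sum w n = top"
      unfolding tail_sum_def
      using summable_suminf_not_top[of "\<lambda>k. w (n + k) / real (n + k)", OF nonneg] by argo
    then show ?thesis
      using False by (simp add: Cstar_def)
  qed
qed

text \<open>
  Here the series for \<open>x\<close> may converge only conditionally; the right-hand side is then infinite.
\<close>

lemma Cstar_le_tail_sum_abs:
  assumes x: "x \<in> dom_Cstar"
  shows "e2ennreal \<bar>Cstar x n\<bar> \<le> tail_sum (\<lambda>k. \<bar>x k\<bar>) n"
proof -
  let ?f = "\<lambda>k. \<bar>x (n + k) / real (n + k)\<bar>"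
  have tail: "tail_sum (\<lambda>k. \<bar>x k\<bar>) n = (\<Sum>k. ennreal (?f k))"
    by (simp only: tail_sum_def abs_divide abs_of_nat)
  show ?thesis
  proof (cases "summable ?f")
    case True
    have "e2ennreal \<bar>Cstar x n\<bar> = ennreal \<bar>\<Sum>k. x (n + k) / real (n + k)\<bar>"
      using x by (simp only: Cstar_def if_True abs_ereal.simps e2ennreal_ereal)
    also have "\<dots> \<le> ennreal (\<Sum>k. ?f k)"
      using summable_rabs[OF True] by (rule ennreal_leI)
    also have "\<dots> = tail_sum (\<lambda>k. \<bar>x k\<bar>) n"
      unfolding tail by (rule suminf_ennreal2[OF abs_ge_zero True, symmetric])
    finally show ?thesis .
  next
    case False
    then have "(\<Sum>k. ennreal (?f k)) = top"
      using summable_suminf_not_top[of ?f, OF abs_ge_zero] by argo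
    then show ?thesis
      unfolding tail by (simp only: top_greatest)
  qed
qed

lemma tail_sum_le_mult:
  assumes n: "n \<ge> 1" and le: "\<And>k. k \<ge> 1 \<Longrightarrow> ennreal (y k) \<le> R * ennreal (w k)"
    and w: "w \<in> nonneg_seqs" and y: "y \<in> nonneg_seqs"
  shows "tail_sum y n \<le> R * tail_sum w n"
proof -
  have split: "ennreal (z k / real k) = ennreal (z k) * ennreal (1 / real k)"
    if "z \<in> nonneg_seqs" "k \<ge> 1" for z k
    using that by (simp add: nonneg_seqs_def flip: ennreal_mult)
  have "ennreal (y k / real k) \<le> R * ennreal (w k / real k)" if "k \<ge> 1" for k
    using mult_right_mono[OF le[OF that], of "ennreal (1 / real k)"]
    by (simp add: split[OF w that] split[OF y that] mult.assoc)
  then have "tail_sum y n \<le> (\<Sum>k. R * ennreal (w (n + k) / real (n + k)))"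
    unfolding tail_sum_def using n by (intro suminf_le summableI) (simp_all del: of_nat_add)
  then show ?thesis
    by (simp add: tail_sum_def)
qed

lemma linf_norm_Cstar_nonneg:
  assumes "w \<in> nonneg_seqs"
  shows "linf_norm v (Cstar w) = (SUP n\<in>{1..}. ennreal (v n) * tail_sum w n)"
  unfolding linf_norm_def using Cstar_nonneg[OF assms]
  by (intro SUP_cong) (auto simp: mult.commute)

section \<open>Sharpness by truncation\<close>

lemma truncate_nonneg: "w \<in> nonneg_seqs \<Longrightarrow> truncate N w \<in> nonneg_seqs"
  by (simp add: nonneg_seqs_def truncate_def)

lemma truncate_noninc: "w \<in> noninc_seqs \<Longrightarrow> truncate N w \<in> noninc_seqs"
  by (auto simp: noninc_seqs_def nonneg_seqs_def truncate_def monotone_on_def)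

lemma truncate_dom: "truncate N w \<in> dom_Cstar"
  unfolding dom_Cstar_def mem_Collect_eq
  by (rule summable_finite[of "{..<N}"]) (auto simp: truncate_def)

lemma tail_sum_truncate:
  "tail_sum (truncate (n + M) w) n = (\<Sum>k<M. ennreal (w (n + k) / real (n + k)))"
  unfolding tail_sum_def
  by (subst suminf_finite[of "{..<M}"]) (auto simp: truncate_def)

lemma ratio_sup_truncate_le_1:
  assumes "w \<in> nonneg_seqs" and "\<And>k. k \<ge> 1 \<Longrightarrow> w k \<le> u k"
  shows "ratio_sup u (truncate N w) \<le> 1"
  unfolding ratio_sup_def
proof (rule SUP_least)
  fix k :: nat
  assume "k \<in> {1..}"
  then have k: "k \<ge> 1" by simp
  have "\<bar>truncate N w k\<bar> \<le> u k" "0 \<le> u k"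
    using assms(1) assms(2)[OF k] k by (auto simp: truncate_def nonneg_seqs_def)
  then have "ennreal \<bar>truncate N w k\<bar> / ennreal (u k) \<le> ennreal (u k) / ennreal (u k)"
    by (intro divide_right_mono_ennreal ennreal_leI)
  also have "\<dots> \<le> 1"
    by (cases "ennreal (u k) = 0") auto
  finally show "ennreal \<bar>truncate N w k\<bar> / ennreal (u k) \<le> 1" .
qed

lemma abs_le_ratio_sup:
  assumes "ratio_sup u x \<noteq> top" and "k \<ge> 1"
  shows "ennreal \<bar>x k\<bar> \<le> ratio_sup u x * ennreal (u k)"
proof -
  have le: "ennreal \<bar>x k\<bar> / ennreal (u k) \<le> ratio_sup u x"
    unfolding ratio_sup_def using assms(2) by (intro SUP_upper) auto
  show ?thesis
  proof (cases "ennreal (u k) = 0")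
    case True
    \<comment> \<open>A nonzero \<open>x k\<close> over \<open>u k = 0\<close> would make the supremum infinite, so \<open>x k = 0\<close>.\<close>
    then show ?thesis
      using le assms(1) by (auto simp: top_unique split: if_splits)
  next
    case False
    have "ennreal \<bar>x k\<bar> = ennreal \<bar>x k\<bar> / ennreal (u k) * ennreal (u k)"
      using False mult_divide_eq_ennreal[of "ennreal (u k)" "ennreal \<bar>x k\<bar>"]
      by (simp add: ennreal_times_divide mult.commute)
    also have "\<dots> \<le> ratio_sup u x * ennreal (u k)"
      using le by (rule mult_right_mono) simp
    finally show ?thesis .
  qed
qed

text \<open>
  The inequality follows by summing \<open>maj\<close> over a tail, and the common factor \<open>ratio_sup u x\<close> comes
  out of the sum. Since \<open>w \<le> u\<close>, the truncations of \<open>w\<close> are competitors with ratio at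
  most \<open>1\<close>; by monotone convergence they show that the constant cannot be lowered.
\<close>

lemma best_constant_of_majorant:
  assumes w: "w \<in> nonneg_seqs" and le: "\<And>k. k \<ge> 1 \<Longrightarrow> w k \<le> u k"
    and dom: "X \<subseteq> dom_Cstar" and trunc: "\<And>N. truncate N w \<in> X"
    and maj: "\<And>x k. x \<in> X \<Longrightarrow> ratio_sup u x \<noteq> top \<Longrightarrow> k \<ge> 1 \<Longrightarrow>
                ennreal \<bar>x k\<bar> \<le> ratio_sup u x * ennreal (w k)"
  shows "best_constant u v X (linf_norm v (Cstar w))"
  unfolding best_constant_def
proof (intro conjI ballI allI impI)
  fix x
  assume x: "x \<in> X"
  show "Cstar_ineq u v (linf_norm v (Cstar w)) x"
  proof (cases "ratio_sup u x = top")
    case True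
    then show ?thesis by (simp add: Cstar_ineq_def)
  next
    case False
    have "linf_norm v (Cstar x) \<le> linf_norm v (Cstar w) * ratio_sup u x"
      unfolding linf_norm_def[of v "Cstar x"]
    proof (rule SUP_least)
      fix n :: nat
      assume "n \<in> {1..}"
      then have n: "n \<ge> 1" by simp
      have "e2ennreal \<bar>Cstar x n\<bar> \<le> tail_sum (\<lambda>k. \<bar>x k\<bar>) n"
        using x dom by (intro Cstar_le_tail_sum_abs) auto
      also have "\<dots> \<le> ratio_sup u x * tail_sum w n"
        using n w maj[OF x False] by (intro tail_sum_le_mult) (auto simp: nonneg_seqs_def)
      finally have "e2ennreal \<bar>Cstar x n\<bar> * ennreal (v n)
          \<le> ratio_sup u x * tail_sum w n * ennreal (v n)"
        by (rule mult_right_mono) simp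
      also have "\<dots> = (ennreal (v n) * tail_sum w n) * ratio_sup u x"
        by (simp add: ac_simps)
      also have "\<dots> \<le> linf_norm v (Cstar w) * ratio_sup u x"
        unfolding linf_norm_Cstar_nonneg[OF w]
        using n by (intro mult_right_mono SUP_upper) auto
      finally show "e2ennreal \<bar>Cstar x n\<bar> * ennreal (v n)
          \<le> linf_norm v (Cstar w) * ratio_sup u x" .
    qed
    then show ?thesis by (simp add: Cstar_ineq_def)
  qed
next
  fix B
  assume B: "\<forall>x\<in>X. Cstar_ineq u v B x"
  have partial: "ennreal (v n) * (\<Sum>k<M. ennreal (w (n + k) / real (n + k))) \<le> B"
    if n: "n \<ge> 1" for n M
  proof -
    let ?t = "truncate (n + M) w"
    have ratio: "ratio_sup u ?t \<le> 1"
      by (rule ratio_sup_truncate_le_1[OF w le])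
    then have "ratio_sup u ?t \<noteq> top"
      by (auto simp: top_unique)
    then have bound: "linf_norm v (Cstar ?t) \<le> B * ratio_sup u ?t"
      using B trunc by (auto simp: Cstar_ineq_def)
    have "ennreal (v n) * tail_sum ?t n \<le> linf_norm v (Cstar ?t)"
      unfolding linf_norm_Cstar_nonneg[OF truncate_nonneg[OF w]]
      using n by (intro SUP_upper) auto
    also note bound
    also have "B * ratio_sup u ?t \<le> B"
      using mult_left_mono[OF ratio, of B] by simp
    finally show ?thesis
      by (simp add: tail_sum_truncate)
  qed
  show "linf_norm v (Cstar w) \<le> B"
    unfolding linf_norm_Cstar_nonneg[OF w] tail_sum_def suminf_eq_SUP SUP_mult_left_ennreal
    using partial by (intro SUP_least) auto
qed

section \<open>Monotone sequences\<close>

lemma down_seq_attained: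
  assumes "k \<ge> 1"
  obtains j where "1 \<le> j" "j \<le> k" "down_seq u k = u j"
proof -
  have "Min (u ` {1..k}) \<in> u ` {1..k}"
    using assms by (intro Min_in) auto
  then show ?thesis
    using that by (auto simp: down_seq_def)
qed

lemma down_seq_le: "1 \<le> j \<Longrightarrow> j \<le> k \<Longrightarrow> down_seq u k \<le> u j"
  unfolding down_seq_def by (intro Min_le) auto

lemma down_seq_noninc:
  assumes "u \<in> nonneg_seqs"
  shows "down_seq u \<in> noninc_seqs"
proof -
  have "0 \<le> down_seq u k" if k: "k \<ge> 1" for k
  proof -
    obtain j where "1 \<le> j" "down_seq u k = u j"
      using down_seq_attained[OF k] by metis
    with assms show ?thesis by (simp add: nonneg_seqs_def)
  qed
  moreover have "down_seq u l \<le> down_seq u k" if "1 \<le> k" "k \<le> l" for k l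
  proof -
    obtain j where "1 \<le> j" "j \<le> k" "down_seq u k = u j"
      using down_seq_attained[OF \<open>1 \<le> k\<close>] by metis
    with \<open>k \<le> l\<close> show ?thesis by (simp add: down_seq_le)
  qed
  ultimately show ?thesis
    by (auto simp: noninc_seqs_def nonneg_seqs_def monotone_on_def)
qed

text \<open>
  The bound by \<open>u\<close> is used at the index \<open>j \<le> k\<close> where the running minimum is attained, and
  \<open>x k \<le> x j\<close> carries it over to \<open>k\<close>.
\<close>

lemma noninc_le_ratio_sup_down_seq:
  assumes x: "x \<in> noninc_seqs" and fin: "ratio_sup u x \<noteq> top" and k: "k \<ge> 1"
  shows "ennreal \<bar>x k\<bar> \<le> ratio_sup u x * ennreal (down_seq u k)"
proof -
  obtain j where j: "1 \<le> j" "j \<le> k" "down_seq u k = u j"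
    using down_seq_attained[OF k] .
  have "\<bar>x k\<bar> \<le> \<bar>x j\<bar>"
    using x j by (auto simp: noninc_seqs_def nonneg_seqs_def monotone_on_def)
  then have "ennreal \<bar>x k\<bar> \<le> ennreal \<bar>x j\<bar>"
    by (rule ennreal_leI)
  also have "\<dots> \<le> ratio_sup u x * ennreal (u j)"
    by (rule abs_le_ratio_sup[OF fin j(1)])
  finally show ?thesis
    by (simp add: j)
qed

text \<open>If \<open>x m > 0\<close>, the series is bounded below from \<open>m\<close> on by \<open>x m\<close> times the harmonic series.\<close>

lemma nondec_dom_Cstar: "nondec_seqs \<inter> dom_Cstar = {x. \<forall>n\<ge>1. x n = 0}"
proof (intro set_eqI iffI)
  fix x
  assume "x \<in> nondec_seqs \<inter> dom_Cstar"
  then have nonneg: "\<And>n. n \<ge> 1 \<Longrightarrow> 0 \<le> x n"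
    and mono: "\<And>m n. 1 \<le> m \<Longrightarrow> m \<le> n \<Longrightarrow> x m \<le> x n"
    and dom: "x \<in> dom_Cstar"
    by (auto simp: nondec_seqs_def nonneg_seqs_def monotone_on_def)
  have "x m = 0" if m: "m \<ge> 1" for m
  proof (rule ccontr)
    assume "x m \<noteq> 0"
    with nonneg[OF m] have pos: "x m > 0" by simp
    have "summable (\<lambda>k. x (m + k) / real (m + k))"
      using dom summable_tail_iff[OF m] by blast
    then have "summable (\<lambda>k. x m / real (m + k))"
    proof (rule summable_comparison_test'[where N = 0])
      fix k
      show "norm (x m / real (m + k)) \<le> x (m + k) / real (m + k)"
        using pos mono[OF m, of "m + k"] by (auto intro: divide_right_mono)
    qed
    then have "summable (\<lambda>k. inverse (x m) * (x m / real (k + m)))"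
      by (intro summable_mult) (simp add: add.commute)
    then have "summable (\<lambda>k. inverse (real (k + m)))"
      using pos by (simp add: field_simps)
    then have "summable (\<lambda>k. inverse (real k))"
      by (subst (asm) summable_iff_shift)
    then show False
      using not_summable_harmonic[where 'a = real] by blast
  qed
  then show "x \<in> {x. \<forall>n\<ge>1. x n = 0}" by simp
next
  fix x :: "nat \<Rightarrow> real"
  assume "x \<in> {x. \<forall>n\<ge>1. x n = 0}"
  then show "x \<in> nondec_seqs \<inter> dom_Cstar"
    by (auto simp: nondec_seqs_def nonneg_seqs_def dom_Cstar_def monotone_on_def)
qed

lemma linf_norm_Cstar_zero:
  assumes "\<forall>n\<ge>1. x n = 0"
  shows "linf_norm v (Cstar x) = 0"
proof -
  have "x \<in> nonneg_seqs"
    using assms by (simp add: nonneg_seqs_def)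
  moreover have "tail_sum x n = 0" if "n \<ge> 1" for n
    using assms that by (simp add: tail_sum_def)
  ultimately show ?thesis
    by (simp add: linf_norm_Cstar_nonneg)
qed

section \<open>The best constants\<close>

theorem corollary3p6:
  fixes u v :: "nat \<Rightarrow> real"
  assumes "u \<in> nonneg_seqs" and "v \<in> nonneg_seqs"
  shows "best_constant u v dom_Cstar (linf_norm v (Cstar u))
    \<and> best_constant u v (nonneg_seqs \<inter> dom_Cstar) (linf_norm v (Cstar u))
    \<and> linf_norm v (Cstar u)
        = (SUP n\<in>{1..}. ennreal (v n) * (\<Sum>k. ennreal (u (n + k) / real (n + k))))
    \<and> best_constant u v (noninc_seqs \<inter> dom_Cstar) (linf_norm v (Cstar (down_seq u)))
    \<and> linf_norm v (Cstar (down_seq u))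
        = (SUP n\<in>{1..}. ennreal (v n)
             * (\<Sum>k. ennreal (1 / real (n + k) * Min (u ` {1..n + k}))))
    \<and> best_constant u v (nondec_seqs \<inter> dom_Cstar) 0
    \<and> nondec_seqs \<inter> dom_Cstar = {x. \<forall>n\<ge>1. x n = 0}"
proof (intro conjI)
  have down: "down_seq u \<in> noninc_seqs"
    by (rule down_seq_noninc[OF assms(1)])
  then have down_nonneg: "down_seq u \<in> nonneg_seqs"
    by (simp add: noninc_seqs_def)
  show "best_constant u v dom_Cstar (linf_norm v (Cstar u))"
    by (rule best_constant_of_majorant)
      (auto simp: assms truncate_dom intro: abs_le_ratio_sup)
  show "best_constant u v (nonneg_seqs \<inter> dom_Cstar) (linf_norm v (Cstar u))"
    by (rule best_constant_of_majorant)
      (auto simp: assms truncate_dom truncate_nonneg intro: abs_le_ratio_sup)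
  show "linf_norm v (Cstar u)
      = (SUP n\<in>{1..}. ennreal (v n) * (\<Sum>k. ennreal (u (n + k) / real (n + k))))"
    using linf_norm_Cstar_nonneg[OF assms(1)] by (simp add: tail_sum_def)
  show "best_constant u v (noninc_seqs \<inter> dom_Cstar) (linf_norm v (Cstar (down_seq u)))"
    by (rule best_constant_of_majorant)
      (auto simp: down_nonneg down_seq_le truncate_dom truncate_noninc[OF down]
        intro: noninc_le_ratio_sup_down_seq)
  show "linf_norm v (Cstar (down_seq u))
      = (SUP n\<in>{1..}. ennreal (v n)
           * (\<Sum>k. ennreal (1 / real (n + k) * Min (u ` {1..n + k}))))"
    using linf_norm_Cstar_nonneg[OF down_nonneg] by (simp add: tail_sum_def down_seq_def)
  show "best_constant u v (nondec_seqs \<inter> dom_Cstar) 0"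
    by (simp add: best_constant_def nondec_dom_Cstar Cstar_ineq_def linf_norm_Cstar_zero)
  show "nondec_seqs \<inter> dom_Cstar = {x. \<forall>n\<ge>1. x n = 0}"
    by (rule nondec_dom_Cstar)
qed

end
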